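(* Let $X$ be a separable (real) Banach lattice with positive cone $X^+$. Then (i) the set $(X^+)_N$ of non-support points of $X^+$ is nonempty; (ii) for every $u\in(X^+)_N$, the generating space $(X_u,\|\cdot\|_u)$ is order isometric to a Banach space $C(K)$ for some compact Hausdorff space $K$.
   Context: A point $x\in X^+$ is a support point of $X^+$ if there is a nonzero $x^*\in X^*$ with $\langle x^*,x\rangle=\max\{\langle x^*,y\rangle:y\in X^+\}$; $(X^+)_N$ is the set of points of $X^+$ that are not support points. For $u\in(X^+)_N$, $[-u,u]=\{x\in X:-u\le x\le u\}$, $X_u=C_u\cap(-C_u)$ with $C_u=\bigcup_{\lambda>0}\lambda(X^+-u)$ (equivalently $X_u=\bigcup_{\lambda>0}\lambda[-u,u]$), $\|x\|_u=\inf\{\lambda>0:x\in\lambda[-u,u]\}$, and $X_u$ carries the order of $X$. Order isometric means there is a surjective (linear) isometry $T$ with $Tx\ge Ty\iff x\ge y$. $C(K)$ carries the sup-norm and pointwise order. *)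

theory Defs
  imports "HOL-Analysis.Analysis" "HOL-Library.Lattice_Algebras"
begin

(* lattice_ab_group_add_abs fixes abs x = sup x (- x) *)
class banach_lattice = banach + ordered_real_vector + lattice_ab_group_add_abs +
  assumes norm_lattice_mono: "\<bar>x\<bar> \<le> \<bar>y\<bar> \<Longrightarrow> norm x \<le> norm y"

definition pos_cone :: "'a::banach_lattice set" where
  "pos_cone = {x. 0 \<le> x}"

definition support_point :: "'a::real_normed_vector set \<Rightarrow> 'a \<Rightarrow> bool" where
  "support_point S x \<longleftrightarrow>
     x \<in> S \<and> (\<exists>f :: 'a \<Rightarrow>\<^sub>L real. f \<noteq> 0 \<and> (\<forall>y\<in>S. blinfun_apply f y \<le> blinfun_apply f x))"

definition nonsupport_points :: "'a::real_normed_vector set \<Rightarrow> 'a set" where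
  "nonsupport_points S = {x \<in> S. \<not> support_point S x}"

definition gen_cone :: "'a::banach_lattice \<Rightarrow> 'a set" where
  "gen_cone u = (\<Union>t\<in>{0<..}. {t *\<^sub>R (x - u) | x. x \<in> pos_cone})"

definition gen_space :: "'a::banach_lattice \<Rightarrow> 'a set" where
  "gen_space u = gen_cone u \<inter> uminus ` gen_cone u"

definition gen_norm :: "'a::banach_lattice \<Rightarrow> 'a \<Rightarrow> real" where
  "gen_norm u x = Inf {t. 0 < t \<and> x \<in> (\<lambda>y. t *\<^sub>R y) ` {- u..u}}"

(* Real continuous functions on K, represented by their extensional versions, so that
   equality in the set below is equality on the points of K. *)
definition C_space :: "'k topology \<Rightarrow> ('k \<Rightarrow> real) set" where
  "C_space K = {f \<in> extensional (topspace K). continuous_map K euclideanreal f}"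

(* The inserted 0 only matters when K has no points, where C(K) is the zero space. *)
definition C_norm :: "'k topology \<Rightarrow> ('k \<Rightarrow> real) \<Rightarrow> real" where
  "C_norm K f = Sup (insert 0 ((\<lambda>k. \<bar>f k\<bar>) ` topspace K))"

(* The linear subspace V, with norm N and the order of the ambient space, is order isometric
   to C(K).  The vector operations of C(K) are pointwise on the points of K. *)
definition order_isometric_C ::
  "'a::banach_lattice set \<Rightarrow> ('a \<Rightarrow> real) \<Rightarrow> 'k topology \<Rightarrow> bool" where
  "order_isometric_C V N K \<longleftrightarrow>
     (\<exists>T :: 'a \<Rightarrow> 'k \<Rightarrow> real.
        T ` V = C_space K \<and>
        (\<forall>x\<in>V. \<forall>y\<in>V. \<forall>k\<in>topspace K. T (x + y) k = T x k + T y k) \<and>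
        (\<forall>c. \<forall>x\<in>V. \<forall>k\<in>topspace K. T (c *\<^sub>R x) k = c * T x k) \<and>
        (\<forall>x\<in>V. C_norm K (T x) = N x) \<and>
        (\<forall>x\<in>V. \<forall>y\<in>V. (\<forall>k\<in>topspace K. T y k \<le> T x k) \<longleftrightarrow> y \<le> x))"

end

theory Submission
  imports Defs
begin

text \<open>
  A positive functional vanishing at \<open>u = \<Sum> 2\<^sup>-\<^sup>n |d\<^sub>n| / (1 + \<parallel>d\<^sub>n\<parallel>)\<close>, with \<open>d\<close> dense, vanishes at every \<open>d\<^sub>n\<close>, so
  \<open>u\<close> is not a support point.

  The second part is Kakutani's theorem for the ideal generated by any \<open>u \<ge> 0\<close>.  The space \<open>K\<close>
  consists of the lattice homomorphisms to the reals that are 1 at \<open>u\<close>.  There are enough of them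
  because the gauge \<open>x \<mapsto> inf {r. x \<le> r u}\<close> is sublinear and preserves binary maxima, and a minimal
  functional with these two properties is linear.  Surjectivity onto \<open>C(K)\<close> follows from the
  lattice version of the Stone-Weierstrass theorem and completeness.
\<close>

section \<open>The cone of a Banach lattice\<close>

lemma norm_mono_nonneg:
  fixes x y :: "'a::banach_lattice"
  assumes "0 \<le> x" "x \<le> y"
  shows "norm x \<le> norm y"
  using assms by (intro norm_lattice_mono) (simp add: abs_of_nonneg order_trans)

lemma norm_abs_lattice: "norm \<bar>x\<bar> = norm (x::'a::banach_lattice)"
  by (intro antisym norm_lattice_mono) simp_all

text \<open>Since \<open>x n\<close> is nonnegative, \<open>- l\<close> lies below
  \<open>x n - l\<close>, so the negative part \<open>sup (- l) 0\<close> of the limit is dominated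
  by \<open>\<bar>x n - l\<bar>\<close>. Its norm is therefore 0.\<close>

lemma closed_pos_cone: "closed (pos_cone :: 'a::banach_lattice set)"
  unfolding closed_sequential_limits
proof (intro allI impI, elim conjE)
  fix x :: "nat \<Rightarrow> 'a" and l
  assume x: "\<forall>n. x n \<in> pos_cone" and lim: "x \<longlonglongrightarrow> l"
  have le: "norm (sup (- l) 0) \<le> norm (x n - l)" for n
  proof -
    have "- l \<le> x n - l"
      using x by (simp add: pos_cone_def)
    then have "- l \<le> \<bar>x n - l\<bar>"
      by (meson abs_ge_self order_trans)
    then have "norm (sup (- l) 0) \<le> norm \<bar>x n - l\<bar>"
      by (intro norm_mono_nonneg) simp_all
    then show ?thesis
      by (simp add: norm_abs_lattice)
  qed
  have "(\<lambda>n. norm (x n - l)) \<longlonglongrightarrow> 0"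
    using lim by (simp add: LIM_zero tendsto_norm_zero)
  then have "norm (sup (- l) 0) \<le> 0"
    using le by (intro LIMSEQ_le_const) auto
  then have "sup (- l) 0 = 0"
    by simp
  then have "- l \<le> 0"
    by (metis sup_ge1)
  then show "l \<in> pos_cone"
    by (simp add: pos_cone_def)
qed

lemma tendsto_lattice_le:
  fixes f g :: "'b \<Rightarrow> 'a::banach_lattice"
  assumes "F \<noteq> bot" "(f \<longlongrightarrow> a) F" "(g \<longlongrightarrow> b) F" "eventually (\<lambda>x. f x \<le> g x) F"
  shows "a \<le> b"
proof -
  have "b - a \<in> pos_cone"
  proof (rule Lim_in_closed_set[OF closed_pos_cone _ assms(1)])
    show "((\<lambda>x. g x - f x) \<longlongrightarrow> b - a) F"
      by (intro tendsto_intros assms)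
    show "eventually (\<lambda>x. g x - f x \<in> pos_cone) F"
      using assms(4) by (simp add: pos_cone_def)
  qed
  then show ?thesis
    by (simp add: pos_cone_def)
qed

section \<open>Non-support points\<close>

text \<open>Both \<open>\<bar>x\<bar> + x\<close> and \<open>\<bar>x\<bar> - x\<close> are
  nonnegative, so \<open>f x\<close> and \<open>- f x\<close> are both at most 0.\<close>

lemma nonpos_functional_eq_0_if_abs:
  fixes f :: "'a::banach_lattice \<Rightarrow>\<^sub>L real"
  assumes nonpos: "\<And>y. 0 \<le> y \<Longrightarrow> blinfun_apply f y \<le> 0"
    and "blinfun_apply f \<bar>x\<bar> = 0"
  shows "blinfun_apply f x = 0"
proof -
  have "- x \<le> \<bar>x\<bar>" "x \<le> \<bar>x\<bar>"
    by (rule abs_ge_minus_self abs_ge_self)+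
  then have "0 \<le> \<bar>x\<bar> + x" "0 \<le> \<bar>x\<bar> - x"
    using diff_ge_0_iff_ge[of "\<bar>x\<bar>" "- x"] diff_ge_0_iff_ge[of "\<bar>x\<bar>" x] by auto
  from this[THEN nonpos] have "blinfun_apply f (\<bar>x\<bar> + x) \<le> 0" "blinfun_apply f (\<bar>x\<bar> - x) \<le> 0" .
  then show ?thesis
    using assms(2) by (simp add: blinfun.add_right blinfun.diff_right)
qed

lemma ex_nonsupport_point:
  assumes "separable_space (euclidean :: 'a::banach_lattice topology)"
  shows "nonsupport_points (pos_cone :: 'a set) \<noteq> {}"
proof -
  obtain C :: "'a set" where C: "countable C" "closure C = UNIV"
    using assms unfolding separable_space_def by auto
  then have "C \<noteq> {}"
    by auto
  define d where "d = from_nat_into C"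
  have d: "range d = C"
    unfolding d_def using C \<open>C \<noteq> {}\<close> by (simp add: range_from_nat_into)
  \<comment> \<open>The weights are positive and force \<open>norm (g n)\<close> below
    \<open>(1/2)^n\<close>, so the series converges absolutely.\<close>
  define w where "w n = (1/2)^n / (1 + norm (d n))" for n
  define g where "g n = w n *\<^sub>R \<bar>d n\<bar>" for n
  have w_pos: "0 < w n" for n
    unfolding w_def by (intro divide_pos_pos) (auto simp: add_pos_nonneg)
  have g_nonneg: "0 \<le> g n" for n
    unfolding g_def using w_pos[of n] by (intro scaleR_nonneg_nonneg) auto
  have "norm (g n) \<le> (1/2)^n" for n
  proof -
    have "norm (g n) = (1/2)^n * (norm (d n) / (1 + norm (d n)))"
      using w_pos[of n] by (simp add: g_def w_def norm_abs_lattice)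
    also have "\<dots> \<le> (1/2)^n * 1"
      by (intro mult_left_mono) (auto simp: divide_le_eq add_pos_nonneg)
    finally show ?thesis
      by simp
  qed
  then have g_summable: "summable g"
    by (rule summable_comparison_test'[OF summable_geometric, rotated]) simp
  define u where "u = suminf g"
  have "(\<lambda>n. \<Sum>i<n. g i) \<longlonglongrightarrow> u"
    unfolding u_def using g_summable by (rule summable_LIMSEQ)
  then have u_nonneg: "0 \<le> u"
    using g_nonneg by (intro tendsto_lattice_le[of sequentially "\<lambda>_. 0" 0 "\<lambda>n. \<Sum>i<n. g i"])
      (auto intro!: sum_nonneg always_eventually)
  have "\<not> support_point pos_cone u"
  proof
    assume "support_point pos_cone u"
    then obtain f :: "'a \<Rightarrow>\<^sub>L real" where "f \<noteq> 0"
      and f: "\<And>y. 0 \<le> y \<Longrightarrow> blinfun_apply f y \<le> blinfun_apply f u"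
      unfolding support_point_def pos_cone_def by auto
    \<comment> \<open>Testing maximality at 0 gives \<open>0 \<le> f u\<close>, and at
      \<open>2 *\<^sub>R u\<close> it gives \<open>2 * f u \<le> f u\<close>.\<close>
    have "blinfun_apply f u = 0"
      using f[of 0] f[of "2 *\<^sub>R u"] u_nonneg
      by (simp add: blinfun.zero_right blinfun.scaleR_right scaleR_nonneg_nonneg)
    then have nonpos: "blinfun_apply f y \<le> 0" if "0 \<le> y" for y
      using f[OF that] by simp
    have sums: "(\<lambda>n. - blinfun_apply f (g n)) sums 0"
      using sums_minus[OF bounded_linear.sums[OF blinfun.bounded_linear_right[of f] summable_sums[OF g_summable]]]
        \<open>blinfun_apply f u = 0\<close> by (simp add: u_def)
    \<comment> \<open>A series of nonnegative terms with sum 0 has only zero terms.\<close>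
    have "\<forall>n. - blinfun_apply f (g n) = 0"
      using suminf_eq_zero_iff[OF sums_summable[OF sums]] sums_unique[OF sums] nonpos[OF g_nonneg]
      by simp
    then have "blinfun_apply f \<bar>d n\<bar> = 0" for n
      using w_pos[of n] by (simp add: g_def blinfun.scaleR_right) (metis less_irrefl)
    then have "blinfun_apply f (d n) = 0" for n
      using nonpos by (rule nonpos_functional_eq_0_if_abs[rotated])
    then have "C \<subseteq> {x. blinfun_apply f x = 0}"
      using d by auto
    moreover have "closed {x. blinfun_apply f x = 0}"
      by (intro closed_Collect_eq continuous_intros)
    ultimately have "closure C \<subseteq> {x. blinfun_apply f x = 0}"
      by (rule closure_minimal)
    then have "f = 0"
      using C by (intro blinfun_eqI) auto
    with \<open>f \<noteq> 0\<close> show False ..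
  qed
  then show ?thesis
    using u_nonneg unfolding nonsupport_points_def pos_cone_def by auto
qed

section \<open>A lattice version of the Stone-Weierstrass theorem\<close>

text \<open>The predicate \<open>P\<close> lets one induction serve both \<open>min\<close> and
  \<open>max\<close>: \<open>P\<close> may be \<open>c \<le> _\<close> for \<open>min\<close>, and
  \<open>_ \<le> c\<close> or \<open>_ < c\<close> for \<open>max\<close>. No separate formulas for
  finite minima and maxima are required.\<close>

lemma finite_lattice_closed:
  fixes h :: "'i \<Rightarrow> 'b \<Rightarrow> 'c"
  assumes "finite I" "I \<noteq> {}" "\<And>i. i \<in> I \<Longrightarrow> h i \<in> F"
    and "\<And>f g. f \<in> F \<Longrightarrow> g \<in> F \<Longrightarrow> (\<lambda>x. m (f x) (g x)) \<in> F"
  shows "\<exists>g\<in>F. \<forall>P x. (\<forall>s t. P (m s t) \<longleftrightarrow> P s \<and> P t) \<longrightarrow> (P (g x) \<longleftrightarrow> (\<forall>i\<in>I. P (h i x)))"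
  using assms(1-3)
proof (induction I rule: finite_ne_induct)
  case (singleton i)
  then show ?case
    by (intro bexI[of _ "h i"]) auto
next
  case (insert i I)
  then obtain g where g: "g \<in> F"
    "\<forall>P x. (\<forall>s t. P (m s t) \<longleftrightarrow> P s \<and> P t) \<longrightarrow> (P (g x) \<longleftrightarrow> (\<forall>i\<in>I. P (h i x)))"
    by auto
  show ?case
  proof (rule bexI[of _ "\<lambda>x. m (h i x) (g x)"], intro allI impI)
    fix P :: "'c \<Rightarrow> bool" and x
    assume P: "\<forall>s t. P (m s t) \<longleftrightarrow> P s \<and> P t"
    then have "P (m (h i x) (g x)) \<longleftrightarrow> P (h i x) \<and> P (g x)"
      by blast
    also have "P (g x) \<longleftrightarrow> (\<forall>i\<in>I. P (h i x))"
      using g(2) P by blast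
    finally show "P (m (h i x) (g x)) \<longleftrightarrow> (\<forall>j\<in>insert i I. P (h j x))"
      by simp
  next
    show "(\<lambda>x. m (h i x) (g x)) \<in> F"
      using insert.prems g(1) by (intro assms(4)) auto
  qed
qed

text \<open>For fixed \<open>a\<close>, a finite minimum of interpolants through \<open>a\<close>
  and varying \<open>b\<close> stays below \<open>f + e\<close> and still agrees with
  \<open>f\<close> at \<open>a\<close>. A finite maximum of such minima over varying
  \<open>a\<close> then also exceeds \<open>f - e\<close>. Compactness makes both families
  finite.\<close>

lemma lattice_Stone_Weierstrass:
  fixes f :: "'b::topological_space \<Rightarrow> real"
  assumes "compact S" "S \<noteq> {}"
    and cont: "\<And>g. g \<in> F \<Longrightarrow> continuous_on S g"
    and max: "\<And>g h. g \<in> F \<Longrightarrow> h \<in> F \<Longrightarrow> (\<lambda>x. max (g x) (h x)) \<in> F"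
    and min: "\<And>g h. g \<in> F \<Longrightarrow> h \<in> F \<Longrightarrow> (\<lambda>x. min (g x) (h x)) \<in> F"
    and interp: "\<And>a b. a \<in> S \<Longrightarrow> b \<in> S \<Longrightarrow> \<exists>g\<in>F. g a = f a \<and> g b = f b"
    and f: "continuous_on S f" and "0 < e"
  shows "\<exists>g\<in>F. \<forall>x\<in>S. \<bar>f x - g x\<bar> < e"
proof -
  \<comment> \<open>The compactness argument common to both stages: the sets where
    \<open>p b < q b\<close> are relatively open, and the one for \<open>b\<close> contains
    \<open>b\<close>.\<close>
  have cover: "\<exists>I\<subseteq>S. finite I \<and> I \<noteq> {} \<and> (\<forall>x\<in>S. \<exists>b\<in>I. p b x < q b x)"
    if pq: "\<And>b. b \<in> S \<Longrightarrow> continuous_on S (p b)" "\<And>b. b \<in> S \<Longrightarrow> continuous_on S (q b)"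
      "\<And>b. b \<in> S \<Longrightarrow> p b b < q b b" for p q :: "'b \<Rightarrow> 'b \<Rightarrow> real"
  proof -
    have "\<exists>U. open U \<and> U \<inter> S = {x\<in>S. p b x < q b x}" if "b \<in> S" for b
    proof -
      have "continuous_on S (\<lambda>x. q b x - p b x)"
        using that pq by (intro continuous_intros)
      then obtain U where "open U" "U \<inter> S = (\<lambda>x. q b x - p b x) -` {0<..} \<inter> S"
        unfolding continuous_on_open_invariant using open_greaterThan by meson
      then show ?thesis
        by (intro exI[of _ U]) auto
    qed
    then obtain U where U: "\<And>b. b \<in> S \<Longrightarrow> open (U b)"
      "\<And>b. b \<in> S \<Longrightarrow> U b \<inter> S = {x\<in>S. p b x < q b x}"
      by metis
    have S: "S \<subseteq> (\<Union>b\<in>S. U b)"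
      using U(2) pq(3) by blast
    obtain I where I: "I \<subseteq> S" "finite I" "S \<subseteq> (\<Union>b\<in>I. U b)"
      by (rule compactE_image[OF \<open>compact S\<close> U(1) S])
    moreover have "I \<noteq> {}"
      using I(3) \<open>S \<noteq> {}\<close> by auto
    moreover have "\<exists>b\<in>I. p b x < q b x" if "x \<in> S" for x
      using I that U(2) by blast
    ultimately show ?thesis
      by blast
  qed
  have upper: "\<exists>g\<in>F. g a = f a \<and> (\<forall>x\<in>S. g x < f x + e)" if a: "a \<in> S" for a
  proof -
    obtain h where h: "\<And>b. b \<in> S \<Longrightarrow> h b \<in> F" "\<And>b. b \<in> S \<Longrightarrow> h b a = f a"
      "\<And>b. b \<in> S \<Longrightarrow> h b b = f b"
      using interp[OF a] by metis
    have "\<exists>I\<subseteq>S. finite I \<and> I \<noteq> {} \<and> (\<forall>x\<in>S. \<exists>b\<in>I. h b x < f x + e)"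
      using h f \<open>0 < e\<close> by (intro cover) (auto intro: cont continuous_on_add)
    then obtain I where I: "I \<subseteq> S" "finite I" "I \<noteq> {}" "\<forall>x\<in>S. \<exists>b\<in>I. h b x < f x + e"
      by blast
    obtain g where g: "g \<in> F"
      "\<And>P x. (\<forall>s t. P (min s t) \<longleftrightarrow> P s \<and> P t) \<Longrightarrow> P (g x) \<longleftrightarrow> (\<forall>i\<in>I. P (h i x))"
      using finite_lattice_closed[OF I(2,3), of h F min] h(1) I(1) min by blast
    have le: "c \<le> g x \<longleftrightarrow> (\<forall>i\<in>I. c \<le> h i x)" for c x
      by (rule g(2)) simp
    have "g a = f a"
    proof (rule antisym)
      show "g a \<le> f a"
        using le[of "g a" a] I(1,3) h(2) by (metis all_not_in_conv order_refl subsetD)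
      show "f a \<le> g a"
        using le[of "f a" a] I(1) h(2) by auto
    qed
    \<comment> \<open>Taking \<open>c = g x\<close> in \<open>le\<close> puts \<open>g x\<close>
      below every \<open>h i x\<close>, one of which is smaller than \<open>f x + e\<close>.\<close>
    moreover have "g x < f x + e" if "x \<in> S" for x
      using le[of "g x" x] I(4) that by fastforce
    ultimately show ?thesis
      using g(1) by blast
  qed
  obtain h where h: "\<And>a. a \<in> S \<Longrightarrow> h a \<in> F" "\<And>a. a \<in> S \<Longrightarrow> h a a = f a"
    "\<And>a x. a \<in> S \<Longrightarrow> x \<in> S \<Longrightarrow> h a x < f x + e"
    using upper by metis
  have "\<exists>I\<subseteq>S. finite I \<and> I \<noteq> {} \<and> (\<forall>x\<in>S. \<exists>b\<in>I. f x - e < h b x)"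
    using h f \<open>0 < e\<close> by (intro cover) (auto intro: cont continuous_on_diff)
  then obtain I where I: "I \<subseteq> S" "finite I" "I \<noteq> {}" "\<forall>x\<in>S. \<exists>b\<in>I. f x - e < h b x"
    by blast
  obtain g where g: "g \<in> F"
    "\<And>P x. (\<forall>s t. P (max s t) \<longleftrightarrow> P s \<and> P t) \<Longrightarrow> P (g x) \<longleftrightarrow> (\<forall>i\<in>I. P (h i x))"
    using finite_lattice_closed[OF I(2,3), of h F max] h(1) I(1) max by blast
  have "\<bar>f x - g x\<bar> < e" if x: "x \<in> S" for x
  proof -
    have "g x \<le> g x \<longleftrightarrow> (\<forall>i\<in>I. h i x \<le> g x)"
      by (rule g(2)) simp
    then have "f x - e < g x"
      using I(4) x by fastforce
    moreover have "g x < f x + e \<longleftrightarrow> (\<forall>i\<in>I. h i x < f x + e)"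
      by (rule g(2)) simp
    ultimately show ?thesis
      using h(3) I(1) x by auto
  qed
  then show ?thesis
    using g(1) by blast
qed

section \<open>Max-preserving sublinear functionals\<close>

locale vector_sublattice =
  fixes E :: "'a::banach_lattice set"
  assumes add_mem: "x \<in> E \<Longrightarrow> y \<in> E \<Longrightarrow> x + y \<in> E"
    and scaleR_mem: "x \<in> E \<Longrightarrow> c *\<^sub>R x \<in> E"
    and sup_mem: "x \<in> E \<Longrightarrow> y \<in> E \<Longrightarrow> sup x y \<in> E"
begin

lemma minus_mem: "x \<in> E \<Longrightarrow> - x \<in> E"
  using scaleR_mem[of x "-1"] by simp

lemma diff_mem: "x \<in> E \<Longrightarrow> y \<in> E \<Longrightarrow> x - y \<in> E"
  using add_mem[of x "- y"] minus_mem by simp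

text \<open>Fixing the value 0 outside \<open>E\<close> makes functionals that agree on
  \<open>E\<close> equal, so that minimality can be stated with equality and the pointwise order of
  functions.\<close>

definition max_sublinear :: "('a \<Rightarrow> real) \<Rightarrow> bool" where
  "max_sublinear p \<longleftrightarrow>
     (\<forall>x\<in>E. \<forall>y\<in>E. p (x + y) \<le> p x + p y) \<and>
     (\<forall>x\<in>E. \<forall>c>0. p (c *\<^sub>R x) = c * p x) \<and>
     (\<forall>x\<in>E. \<forall>y\<in>E. p (sup x y) = max (p x) (p y)) \<and>
     (\<forall>x. x \<notin> E \<longrightarrow> p x = 0)"

context
  fixes p assumes p: "max_sublinear p"
begin

lemma max_sublinear_add: "x \<in> E \<Longrightarrow> y \<in> E \<Longrightarrow> p (x + y) \<le> p x + p y"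
  and max_sublinear_sup: "x \<in> E \<Longrightarrow> y \<in> E \<Longrightarrow> p (sup x y) = max (p x) (p y)"
  and max_sublinear_outside: "x \<notin> E \<Longrightarrow> p x = 0"
  using p unfolding max_sublinear_def by auto

lemma max_sublinear_zero: "p 0 = 0"
proof (cases "0 \<in> E")
  case True
  then have "p (2 *\<^sub>R 0) = 2 * p 0"
    using p unfolding max_sublinear_def by (metis zero_less_numeral)
  then show ?thesis
    by simp
qed (rule max_sublinear_outside)

lemma max_sublinear_scaleR: "x \<in> E \<Longrightarrow> 0 \<le> c \<Longrightarrow> p (c *\<^sub>R x) = c * p x"
  using p max_sublinear_zero unfolding max_sublinear_def by (cases "c = 0") auto

text \<open>This is \<open>0 = p (x - x) \<le> p x + p (- x)\<close>. It bounds from below every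
  functional under a given one, so infima of chains exist.\<close>

lemma max_sublinear_minus:
  assumes "x \<in> E"
  shows "- p (- x) \<le> p x"
  using max_sublinear_add[OF assms minus_mem[OF assms]] max_sublinear_zero by simp

end

text \<open>Serves two families: the shifts \<open>g t\<close> of one functional, whose members need
  not be sublinear themselves, and the chains in Zorn's lemma. Subadditivity and homogeneity are
  therefore asked only up to passing to another member of \<open>G\<close>. Total ordering of
  \<open>G\<close> is what lets the infimum preserve maxima.\<close>

lemma max_sublinear_INF:
  assumes "G \<noteq> {}"
    and bdd: "\<And>x. x \<in> E \<Longrightarrow> bdd_below ((\<lambda>g. g x) ` G)"
    and chain: "\<And>g h. g \<in> G \<Longrightarrow> h \<in> G \<Longrightarrow> (\<forall>x\<in>E. g x \<le> h x) \<or> (\<forall>x\<in>E. h x \<le> g x)"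
    and add: "\<And>g h. g \<in> G \<Longrightarrow> h \<in> G \<Longrightarrow> \<exists>k\<in>G. \<forall>x\<in>E. \<forall>y\<in>E. k (x + y) \<le> g x + h y"
    and scale: "\<And>g c. g \<in> G \<Longrightarrow> 0 < c \<Longrightarrow> \<exists>k\<in>G. \<forall>x\<in>E. k (c *\<^sub>R x) \<le> c * g x"
    and sup: "\<And>g x y. g \<in> G \<Longrightarrow> x \<in> E \<Longrightarrow> y \<in> E \<Longrightarrow> g (sup x y) = max (g x) (g y)"
  shows "max_sublinear (\<lambda>x. if x \<in> E then INF g\<in>G. g x else 0)" (is "max_sublinear ?q")
proof -
  have lower: "?q x \<le> g x" if "x \<in> E" "g \<in> G" for x g
    using that bdd by (auto intro!: cINF_lower)
  have greatest: "c \<le> ?q x" if "x \<in> E" "\<And>g. g \<in> G \<Longrightarrow> c \<le> g x" for x c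
    using that \<open>G \<noteq> {}\<close> by (auto intro!: cINF_greatest)
  have approx: "\<exists>g\<in>G. g x < c" if "x \<in> E" "?q x < c" for x c
    using greatest[OF that(1), of c] that(2) by (meson leD leI)
  have add_q: "?q (x + y) \<le> ?q x + ?q y" if xy: "x \<in> E" "y \<in> E" for x y
  proof -
    have "?q (x + y) \<le> g x + h y" if gh: "g \<in> G" "h \<in> G" for g h
    proof -
      obtain k where "k \<in> G" "k (x + y) \<le> g x + h y"
        using add[OF gh] xy by blast
      then show ?thesis
        using lower[of "x + y" k] add_mem xy by force
    qed
    then have "?q (x + y) - h y \<le> g x" if "g \<in> G" "h \<in> G" for g h
      using that by (simp add: algebra_simps)
    then have "?q (x + y) - h y \<le> ?q x" if "h \<in> G" for h
      using that xy by (intro greatest) auto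
    then have "?q (x + y) - ?q x \<le> ?q y"
      using xy by (intro greatest) (auto simp: algebra_simps)
    then show ?thesis
      by simp
  qed
  have scale_le: "?q (c *\<^sub>R x) \<le> c * ?q x" if x: "x \<in> E" and c: "0 < c" for x c
  proof -
    have "?q (c *\<^sub>R x) / c \<le> g x" if g: "g \<in> G" for g
    proof -
      obtain k where "k \<in> G" "k (c *\<^sub>R x) \<le> c * g x"
        using scale[OF g c] x by blast
      then have "?q (c *\<^sub>R x) \<le> c * g x"
        using lower[of "c *\<^sub>R x" k] scaleR_mem x by force
      then show ?thesis
        using c by (simp add: pos_divide_le_eq mult.commute)
    qed
    then have "?q (c *\<^sub>R x) / c \<le> ?q x"
      using x by (intro greatest) auto
    then show ?thesis
      using c by (simp add: pos_divide_le_eq mult.commute)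
  qed
  have scale_q: "?q (c *\<^sub>R x) = c * ?q x" if x: "x \<in> E" and c: "0 < c" for x c
  proof (rule antisym)
    show "?q (c *\<^sub>R x) \<le> c * ?q x"
      by (rule scale_le[OF x c])
    \<comment> \<open>The reverse inequality is \<open>scale_le\<close> with factor
      \<open>inverse c\<close> at the point \<open>c *\<^sub>R x\<close>.\<close>
    have "?q (inverse c *\<^sub>R (c *\<^sub>R x)) \<le> inverse c * ?q (c *\<^sub>R x)"
      using x c by (intro scale_le scaleR_mem) auto
    moreover have "inverse c *\<^sub>R (c *\<^sub>R x) = x"
      using c by simp
    ultimately have "?q x \<le> inverse c * ?q (c *\<^sub>R x)"
      by (simp only:)
    then show "c * ?q x \<le> ?q (c *\<^sub>R x)"
      using c by (simp add: field_simps)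
  qed
  have sup_q: "?q (sup x y) = max (?q x) (?q y)" if xy: "x \<in> E" "y \<in> E" for x y
  proof (rule antisym)
    have "?q x \<le> g (sup x y)" "?q y \<le> g (sup x y)" if "g \<in> G" for g
      using lower[OF xy(1) that] lower[OF xy(2) that] sup[OF that xy] by linarith+
    then show "max (?q x) (?q y) \<le> ?q (sup x y)"
      using sup_mem[OF xy] by (intro max.boundedI greatest) auto
    \<comment> \<open>Otherwise one member is small at \<open>x\<close> and one is small at
      \<open>y\<close>. The smaller of the two is small at both, hence at \<open>sup x y\<close>,
      below the infimum there.\<close>
    show "?q (sup x y) \<le> max (?q x) (?q y)"
    proof (rule ccontr)
      assume "\<not> ?thesis"
      then have "?q x < ?q (sup x y)" "?q y < ?q (sup x y)"
        by linarith+
      then obtain g h where gh: "g \<in> G" "g x < ?q (sup x y)" "h \<in> G" "h y < ?q (sup x y)"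
        using approx xy by meson
      then obtain k where "k \<in> G" "k x < ?q (sup x y)" "k y < ?q (sup x y)"
        using chain[OF gh(1,3)] xy by (meson order_le_less_trans)
      then show False
        using lower[OF sup_mem[OF xy], of k] sup[OF _ xy, of k] by linarith
    qed
  qed
  show ?thesis
    unfolding max_sublinear_def using add_q scale_q sup_q by simp
qed

text \<open>The witness is \<open>q x = inf {p (x + t a) - t p a | t. t \<ge> 0}\<close>, which still
  preserves maxima because \<open>p (x + t a) - t p a\<close> decreases in \<open>t\<close>.\<close>

lemma max_sublinear_shift:
  assumes p: "max_sublinear p" and a: "a \<in> E"
  shows "\<exists>q. max_sublinear q \<and> q \<le> p \<and> q (- a) \<le> - p a"
proof -
  define g where "g t x = p (x + t *\<^sub>R a) - t * p a" for t x
  define G where "G = g ` {0..}"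
  define q where "q x = (if x \<in> E then INF h\<in>G. h x else 0)" for x
  note mem = add_mem scaleR_mem a
  have ta: "p (t *\<^sub>R a) = t * p a" if "0 \<le> t" for t
    using max_sublinear_scaleR[OF p a that] .
  have bdd: "bdd_below ((\<lambda>h. h x) ` G)" if x: "x \<in> E" for x
  proof (rule bdd_belowI2)
    fix h assume "h \<in> G"
    then obtain t where t: "0 \<le> t" "h = g t"
      by (auto simp: G_def)
    \<comment> \<open>The left side is \<open>p (t *\<^sub>R a) = t * p a\<close>, so subadditivity
      bounds \<open>g t x\<close> below independently of \<open>t\<close>.\<close>
    have "p ((x + t *\<^sub>R a) + - x) \<le> p (x + t *\<^sub>R a) + p (- x)"
      using x by (intro max_sublinear_add[OF p] mem minus_mem)
    then show "- p (- x) \<le> h x"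
      using t ta by (simp add: g_def)
  qed
  have decr: "g t x \<le> g s x" if "0 \<le> s" "s \<le> t" "x \<in> E" for s t x
  proof -
    have "p ((x + s *\<^sub>R a) + (t - s) *\<^sub>R a) \<le> p (x + s *\<^sub>R a) + p ((t - s) *\<^sub>R a)"
      using that by (intro max_sublinear_add[OF p] mem)
    moreover have "(x + s *\<^sub>R a) + (t - s) *\<^sub>R a = x + t *\<^sub>R a"
      by (simp add: algebra_simps)
    ultimately show ?thesis
      using that ta[of "t - s"] by (simp add: g_def algebra_simps)
  qed
  have "max_sublinear q"
    unfolding q_def
  proof (rule max_sublinear_INF)
    show "G \<noteq> {}"
      by (auto simp: G_def)
    show "bdd_below ((\<lambda>h. h x) ` G)" if "x \<in> E" for x
      using that by (rule bdd)
    show "(\<forall>x\<in>E. h x \<le> k x) \<or> (\<forall>x\<in>E. k x \<le> h x)" if "h \<in> G" "k \<in> G" for h k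
      using that decr unfolding G_def by (metis (no_types, lifting) atLeast_iff imageE linear)
  next
    fix h k assume "h \<in> G" "k \<in> G"
    then obtain s t where st: "0 \<le> s" "0 \<le> t" "h = g s" "k = g t"
      by (auto simp: G_def)
    \<comment> \<open>Under addition of arguments the parameters add; under scaling by
      \<open>c\<close> the parameter is multiplied by \<open>c\<close>.\<close>
    have "g (s + t) (x + y) \<le> h x + k y" if "x \<in> E" "y \<in> E" for x y
    proof -
      have "p ((x + s *\<^sub>R a) + (y + t *\<^sub>R a)) \<le> p (x + s *\<^sub>R a) + p (y + t *\<^sub>R a)"
        using that by (intro max_sublinear_add[OF p] mem)
      moreover have "(x + s *\<^sub>R a) + (y + t *\<^sub>R a) = x + y + (s + t) *\<^sub>R a"
        by (simp add: algebra_simps)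
      ultimately show ?thesis
        by (simp add: st g_def algebra_simps)
    qed
    then show "\<exists>l\<in>G. \<forall>x\<in>E. \<forall>y\<in>E. l (x + y) \<le> h x + k y"
      using st by (intro bexI[of _ "g (s + t)"]) (auto simp: G_def)
  next
    fix h and c :: real assume "h \<in> G" and c: "0 < c"
    then obtain t where t: "0 \<le> t" "h = g t"
      by (auto simp: G_def)
    have "g (c * t) (c *\<^sub>R x) \<le> c * h x" if "x \<in> E" for x
    proof -
      have "p (c *\<^sub>R (x + t *\<^sub>R a)) = c * p (x + t *\<^sub>R a)"
        using that c by (intro max_sublinear_scaleR[OF p] mem) auto
      then show ?thesis
        by (simp add: t g_def algebra_simps)
    qed
    then show "\<exists>k\<in>G. \<forall>x\<in>E. k (c *\<^sub>R x) \<le> c * h x"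
      using t c by (intro bexI[of _ "g (c * t)"]) (auto simp: G_def)
  next
    fix h x y assume "h \<in> G" and xy: "x \<in> E" "y \<in> E"
    then obtain t where t: "0 \<le> t" "h = g t"
      by (auto simp: G_def)
    have "p (sup (x + t *\<^sub>R a) (y + t *\<^sub>R a)) = max (p (x + t *\<^sub>R a)) (p (y + t *\<^sub>R a))"
      using xy by (intro max_sublinear_sup[OF p] mem)
    then show "h (sup x y) = max (h x) (h y)"
      by (simp add: t g_def add_sup_distrib_right max_diff_distrib_left)
  qed
  moreover have q_le: "q x \<le> g t x" if "x \<in> E" "0 \<le> t" for x t
    using that bdd[OF that(1)] by (auto simp: q_def G_def intro!: cINF_lower)
  have "q x \<le> p x" for x
    using q_le[of x 0] max_sublinear_outside[OF p, of x] by (cases "x \<in> E") (auto simp: g_def q_def)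
  then have "q \<le> p"
    by (simp add: le_fun_def)
  \<comment> \<open>The member with \<open>t = 1\<close> has value \<open>p 0 - p a\<close> at
    \<open>- a\<close>.\<close>
  moreover have "q (- a) \<le> - p a"
    using q_le[of "- a" 1] minus_mem[OF a] max_sublinear_zero[OF p] by (simp add: g_def)
  ultimately show ?thesis
    by blast
qed

lemma ex_minimal_max_sublinear:
  assumes p: "max_sublinear p"
  shows "\<exists>m. max_sublinear m \<and> m \<le> p \<and> (\<forall>q. max_sublinear q \<longrightarrow> q \<le> m \<longrightarrow> q = m)"
proof -
  define A where "A = {q. max_sublinear q \<and> q \<le> p}"
  \<comment> \<open>The order is reversed because \<open>predicate_Zorn\<close> yields maximal
    elements.\<close>
  define R where "R = (\<lambda>q r :: 'a \<Rightarrow> real. r \<le> q)"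
  have "\<exists>m\<in>A. \<forall>q\<in>A. R m q \<longrightarrow> q = m"
  proof (rule predicate_Zorn)
    show "partial_order_on A (relation_of R A)"
      by (auto simp: partial_order_on_def preorder_on_def refl_on_def relation_of_def R_def
          intro!: transI antisymI)
    fix C assume "C \<in> Chains (relation_of R A)"
    then have C: "C \<subseteq> A" "\<And>q r. q \<in> C \<Longrightarrow> r \<in> C \<Longrightarrow> q \<le> r \<or> r \<le> q"
      unfolding Chains_def relation_of_def R_def by auto
    show "\<exists>m\<in>A. \<forall>q\<in>C. R q m"
    proof (cases "C = {}")
      case True
      then show ?thesis
        using p by (auto simp: A_def)
    next
      case False
      define m where "m x = (if x \<in> E then INF q\<in>C. q x else 0)" for x
      have msl: "max_sublinear q" "q \<le> p" if "q \<in> C" for q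
        using that C(1) by (auto simp: A_def)
      \<comment> \<open>From \<open>q \<le> p\<close> follows
        \<open>- p (- x) \<le> - q (- x) \<le> q x\<close>.\<close>
      have bdd: "bdd_below ((\<lambda>q. q x) ` C)" if x: "x \<in> E" for x
      proof (rule bdd_belowI2)
        fix q assume "q \<in> C"
        then show "- p (- x) \<le> q x"
          using max_sublinear_minus[OF msl(1) x] msl(2)[of q] by (force dest: le_funD[of _ _ "- x"])
      qed
      have "max_sublinear m"
        unfolding m_def
      proof (rule max_sublinear_INF[OF False bdd])
        fix q r assume qr: "q \<in> C" "r \<in> C"
        show "(\<forall>x\<in>E. q x \<le> r x) \<or> (\<forall>x\<in>E. r x \<le> q x)"
          using C(2)[OF qr] by (auto simp: le_fun_def)
        then obtain k where k: "k \<in> C" "\<forall>x\<in>E. k x \<le> q x \<and> k x \<le> r x"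
          using qr by (metis order_refl)
        have "k (x + y) \<le> q x + r y" if "x \<in> E" "y \<in> E" for x y
        proof -
          have "k x \<le> q x" "k y \<le> r y"
            using k(2) that by auto
          then show ?thesis
            using max_sublinear_add[OF msl(1)[OF k(1)] that] by linarith
        qed
        then show "\<exists>k\<in>C. \<forall>x\<in>E. \<forall>y\<in>E. k (x + y) \<le> q x + r y"
          using k(1) by blast
      next
        fix q and c :: real assume "q \<in> C" "0 < c"
        then show "\<exists>k\<in>C. \<forall>x\<in>E. k (c *\<^sub>R x) \<le> c * q x"
          using max_sublinear_scaleR[OF msl(1)] by (intro bexI[of _ q]) auto
      next
        fix q x y assume "q \<in> C" "x \<in> E" "y \<in> E"
        then show "q (sup x y) = max (q x) (q y)"
          using max_sublinear_sup[OF msl(1)] by auto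
      qed
      moreover have "m \<le> q" if "q \<in> C" for q
        using that bdd max_sublinear_outside[OF msl(1)[OF that]]
        by (auto simp: le_fun_def m_def intro!: cINF_lower)
      moreover from this have "m \<le> p"
        using False msl(2) by (meson ex_in_conv order_trans)
      ultimately show ?thesis
        by (auto simp: A_def R_def)
    qed
  qed
  then show ?thesis
    unfolding A_def R_def by (metis (no_types, lifting) mem_Collect_eq order_trans)
qed

text \<open>A Hahn-Banach theorem for lattice homomorphisms. The shift of a minimal \<open>m\<close>
  by \<open>x\<close> lies below \<open>m\<close>, hence equals \<open>m\<close>, which gives
  \<open>m (- x) \<le> - m x\<close>. An odd sublinear functional is linear.\<close>

lemma ex_lattice_hom_le:
  assumes "max_sublinear p"
  shows "\<exists>m\<le>p. max_sublinear m \<and> (\<forall>x\<in>E. \<forall>y\<in>E. m (x + y) = m x + m y) \<and>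
    (\<forall>c. \<forall>x\<in>E. m (c *\<^sub>R x) = c * m x)"
proof -
  obtain m where m: "max_sublinear m" "m \<le> p"
    and minimal: "\<And>q. max_sublinear q \<Longrightarrow> q \<le> m \<Longrightarrow> q = m"
    using ex_minimal_max_sublinear[OF assms] by auto
  have minus: "m (- x) = - m x" if x: "x \<in> E" for x
  proof -
    obtain q where "max_sublinear q" "q \<le> m" "q (- x) \<le> - m x"
      using max_sublinear_shift[OF m(1) x] by auto
    then have "m (- x) \<le> - m x"
      using minimal by blast
    then show ?thesis
      using max_sublinear_minus[OF m(1) x] by linarith
  qed
  \<comment> \<open>The missing inequality is subadditivity applied to
    \<open>x = (x + y) + (- y)\<close>.\<close>
  have "m (x + y) = m x + m y" if xy: "x \<in> E" "y \<in> E" for x y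
    using max_sublinear_add[OF m(1) xy] max_sublinear_add[OF m(1) add_mem[OF xy] minus_mem[OF xy(2)]]
      minus[OF xy(2)] by simp
  moreover have "m (c *\<^sub>R x) = c * m x" if x: "x \<in> E" for c x
  proof (cases "0 \<le> c")
    case False
    have "m (c *\<^sub>R x) = m ((- c) *\<^sub>R (- x))"
      by simp
    also have "\<dots> = (- c) * m (- x)"
      using False minus_mem[OF x] by (intro max_sublinear_scaleR[OF m(1)]) auto
    finally show ?thesis
      using minus[OF x] by simp
  qed (rule max_sublinear_scaleR[OF m(1) x])
  ultimately show ?thesis
    using m by blast
qed

end

section \<open>Principal ideals as spaces of continuous functions\<close>

lemma gen_cone_iff: "x \<in> gen_cone u \<longleftrightarrow> (\<exists>t>0. - (t *\<^sub>R u) \<le> x)"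
proof
  assume "x \<in> gen_cone u"
  then obtain t y where "0 < t" "0 \<le> y" "x = t *\<^sub>R (y - u)"
    unfolding gen_cone_def pos_cone_def by auto
  then show "\<exists>t>0. - (t *\<^sub>R u) \<le> x"
    by (intro exI[of _ t]) (simp add: scaleR_diff_right scaleR_nonneg_nonneg)
next
  assume "\<exists>t>0. - (t *\<^sub>R u) \<le> x"
  then obtain t where t: "0 < t" "- (t *\<^sub>R u) \<le> x"
    by auto
  have "0 \<le> x - - (t *\<^sub>R u)"
    using t(2) by (simp only: diff_ge_0_iff_ge)
  then have "0 \<le> inverse t *\<^sub>R (x + t *\<^sub>R u)"
    using t(1) by (intro scaleR_nonneg_nonneg) auto
  moreover have "x = t *\<^sub>R (inverse t *\<^sub>R (x + t *\<^sub>R u) - u)"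
    using t(1) by (simp add: scaleR_diff_right)
  ultimately show "x \<in> gen_cone u"
    unfolding gen_cone_def pos_cone_def using t(1) by blast
qed

lemma mem_scaled_interval:
  fixes x u :: "'a::banach_lattice"
  assumes "0 < t"
  shows "x \<in> (\<lambda>y. t *\<^sub>R y) ` {- u..u} \<longleftrightarrow> - (t *\<^sub>R u) \<le> x \<and> x \<le> t *\<^sub>R u"
proof
  assume "x \<in> (\<lambda>y. t *\<^sub>R y) ` {- u..u}"
  then obtain y where "- u \<le> y" "y \<le> u" "x = t *\<^sub>R y"
    by auto
  then show "- (t *\<^sub>R u) \<le> x \<and> x \<le> t *\<^sub>R u"
    using assms scaleR_left_mono[of "- u" y t] scaleR_left_mono[of y u t] by simp
next
  assume x: "- (t *\<^sub>R u) \<le> x \<and> x \<le> t *\<^sub>R u"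
  then have "inverse t *\<^sub>R (- (t *\<^sub>R u)) \<le> inverse t *\<^sub>R x" "inverse t *\<^sub>R x \<le> inverse t *\<^sub>R (t *\<^sub>R u)"
    using assms by (meson inverse_nonnegative_iff_nonnegative less_imp_le scaleR_left_mono)+
  then have "inverse t *\<^sub>R x \<in> {- u..u}"
    using assms by simp
  moreover have "x = t *\<^sub>R (inverse t *\<^sub>R x)"
    using assms by simp
  ultimately show "x \<in> (\<lambda>y. t *\<^sub>R y) ` {- u..u}"
    by blast
qed

text \<open>Connects the gauge form of \<open>gen_norm\<close> with the supremum form of
  \<open>C_norm\<close>. The inserted 0 matches the constraint \<open>0 < t\<close>: the supremum is
  then nonnegative, and adding any \<open>e > 0\<close> gives an admissible
  \<open>t\<close>.\<close>

lemma Inf_pos_upper_bounds: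
  fixes A :: "real set"
  assumes "bdd_above A"
  shows "Inf {t. 0 < t \<and> (\<forall>a\<in>A. a \<le> t)} = Sup (insert 0 A)"
proof (rule antisym)
  let ?s = "Sup (insert 0 A)"
  have upper: "a \<le> ?s" if "a \<in> insert 0 A" for a
    using that assms by (intro cSup_upper) auto
  then have mem: "?s + e \<in> {t. 0 < t \<and> (\<forall>a\<in>A. a \<le> t)}" if "0 < e" for e
    using that by fastforce
  show "?s \<le> Inf {t. 0 < t \<and> (\<forall>a\<in>A. a \<le> t)}"
    using mem[of 1] by (intro cInf_greatest cSup_least) force+
  have "bdd_below {t. 0 < t \<and> (\<forall>a\<in>A. a \<le> t)}"
    by (intro bdd_belowI[of _ 0]) auto
  then show "Inf {t. 0 < t \<and> (\<forall>a\<in>A. a \<le> t)} \<le> ?s"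
    by (metis (no_types, lifting) field_le_epsilon cInf_lower mem)
qed

text \<open>The underlying set of \<open>K\<close>, with the topology of pointwise convergence.
  Vanishing outside \<open>gen_space u\<close> makes each point determined by its values on the
  generating space. Membership is written as an implication under unbounded quantifiers so that
  closedness can be read off clause by clause.\<close>

definition unit_homs :: "'a::banach_lattice \<Rightarrow> ('a \<Rightarrow> real) set" where
  "unit_homs u = {k.
     (\<forall>x. \<forall>y. x \<in> gen_space u \<longrightarrow> y \<in> gen_space u \<longrightarrow> k (x + y) = k x + k y) \<and>
     (\<forall>c. \<forall>x. x \<in> gen_space u \<longrightarrow> k (c *\<^sub>R x) = c * k x) \<and>
     (\<forall>x. \<forall>y. x \<in> gen_space u \<longrightarrow> y \<in> gen_space u \<longrightarrow> k (sup x y) = max (k x) (k y)) \<and>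
     (\<forall>x. x \<notin> gen_space u \<longrightarrow> k x = 0) \<and> k u = 1}"

lemma closed_unit_homs: "closed (unit_homs u)"
  unfolding unit_homs_def
  by (intro closed_Collect_conj closed_Collect_all closed_Collect_imp open_Collect_const
      closed_Collect_eq continuous_on_add continuous_on_mult continuous_on_max continuous_on_const
      continuous_on_product_coordinates)

section \<open>The generating space as a sublattice, and existence of unital homomorphisms\<close>

context
  fixes u :: "'a::banach_lattice"
  assumes u: "0 \<le> u"
begin

lemma mem_gen_space: "x \<in> gen_space u \<longleftrightarrow> (\<exists>t>0. - (t *\<^sub>R u) \<le> x \<and> x \<le> t *\<^sub>R u)"
proof
  assume "x \<in> gen_space u"
  then have "x \<in> gen_cone u" "- x \<in> gen_cone u"
    unfolding gen_space_def by auto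
  then obtain s t where st: "0 < s" "- (s *\<^sub>R u) \<le> x" "0 < t" "- (t *\<^sub>R u) \<le> - x"
    unfolding gen_cone_iff by auto
  have "s *\<^sub>R u \<le> max s t *\<^sub>R u" "t *\<^sub>R u \<le> max s t *\<^sub>R u"
    using u by (auto intro!: scaleR_right_mono)
  then have "- (max s t *\<^sub>R u) \<le> x" "x \<le> max s t *\<^sub>R u"
    using st by (meson neg_le_iff_le order_trans)+
  then show "\<exists>t>0. - (t *\<^sub>R u) \<le> x \<and> x \<le> t *\<^sub>R u"
    using st by (intro exI[of _ "max s t"]) auto
next
  assume "\<exists>t>0. - (t *\<^sub>R u) \<le> x \<and> x \<le> t *\<^sub>R u"
  then have "x \<in> gen_cone u" "- x \<in> gen_cone u"
    unfolding gen_cone_iff by auto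
  then show "x \<in> gen_space u"
    unfolding gen_space_def by (auto intro: image_eqI[of _ _ "- x"])
qed

text \<open>Allowing any real \<open>t\<close> spares sign distinctions in later uses;
  \<open>\<bar>t\<bar> + 1\<close> is a positive replacement because \<open>u\<close> is
  nonnegative.\<close>

lemma gen_spaceI: "- (t *\<^sub>R u) \<le> x \<Longrightarrow> x \<le> t *\<^sub>R u \<Longrightarrow> x \<in> gen_space u"
proof -
  assume x: "- (t *\<^sub>R u) \<le> x" "x \<le> t *\<^sub>R u"
  have "t *\<^sub>R u \<le> (\<bar>t\<bar> + 1) *\<^sub>R u"
    using u by (intro scaleR_right_mono) auto
  then have "- ((\<bar>t\<bar> + 1) *\<^sub>R u) \<le> x" "x \<le> (\<bar>t\<bar> + 1) *\<^sub>R u"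
    using x by (meson neg_le_iff_le order_trans)+
  then show "x \<in> gen_space u"
    unfolding mem_gen_space by (intro exI[of _ "\<bar>t\<bar> + 1"]) auto
qed

interpretation gen: vector_sublattice "gen_space u"
proof
  fix x y assume "x \<in> gen_space u" "y \<in> gen_space u"
  then obtain s t where s: "0 < s" "- (s *\<^sub>R u) \<le> x" "x \<le> s *\<^sub>R u"
    and t: "0 < t" "- (t *\<^sub>R u) \<le> y" "y \<le> t *\<^sub>R u"
    unfolding mem_gen_space by auto
  have "- (s *\<^sub>R u) + - (t *\<^sub>R u) \<le> x + y" "x + y \<le> s *\<^sub>R u + t *\<^sub>R u"
    by (rule add_mono[OF s(2) t(2)], rule add_mono[OF s(3) t(3)])
  then show "x + y \<in> gen_space u"
    by (intro gen_spaceI[of "s + t"]) (simp_all add: scaleR_add_left)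
  have "s *\<^sub>R u \<le> (s + t) *\<^sub>R u" "t *\<^sub>R u \<le> (s + t) *\<^sub>R u"
    using u s t by (auto intro!: scaleR_right_mono)
  then have "- ((s + t) *\<^sub>R u) \<le> x" "x \<le> (s + t) *\<^sub>R u" "y \<le> (s + t) *\<^sub>R u"
    using s t by (meson neg_le_iff_le order_trans)+
  then show "sup x y \<in> gen_space u"
    by (intro gen_spaceI[of "s + t"]) (auto intro: le_supI1)
next
  fix x and c :: real assume "x \<in> gen_space u"
  then obtain t where t: "0 < t" "- (t *\<^sub>R u) \<le> x" "x \<le> t *\<^sub>R u"
    unfolding mem_gen_space by auto
  show "c *\<^sub>R x \<in> gen_space u"
  proof (cases "0 \<le> c")
    case True
    then show ?thesis
      using t scaleR_left_mono[OF t(2), of c] scaleR_left_mono[OF t(3), of c]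
      by (intro gen_spaceI[of "c * t"]) auto
  next
    case False
    then show ?thesis
      using t scaleR_left_mono[OF t(2), of "- c"] scaleR_left_mono[OF t(3), of "- c"]
      by (intro gen_spaceI[of "- c * t"]) (auto dest: le_imp_neg_le)
  qed
qed

lemma unit_mem: "u \<in> gen_space u"
  using u by (intro gen_spaceI[of 1]) (simp_all add: order_trans[of _ 0])

text \<open>The infimum is attained because the cone is closed, and it is finite because
  \<open>u\<close> is nonzero. The resulting equivalence turns each claim about \<open>p\<close>
  into an order inequality in the lattice.\<close>

lemma gen_space_gauge:
  assumes "u \<noteq> 0"
  obtains p where "gen.max_sublinear p" "\<And>x r. x \<in> gen_space u \<Longrightarrow> p x \<le> r \<longleftrightarrow> x \<le> r *\<^sub>R u"
proof -
  define p where "p x = (if x \<in> gen_space u then Inf {r. x \<le> r *\<^sub>R u} else 0)" for x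
  have p_le: "p x \<le> r \<longleftrightarrow> x \<le> r *\<^sub>R u" if x: "x \<in> gen_space u" for x r
  proof -
    let ?S = "{r. x \<le> r *\<^sub>R u}"
    obtain t where t: "0 < t" "- (t *\<^sub>R u) \<le> x" "x \<le> t *\<^sub>R u"
      using x unfolding mem_gen_space by auto
    have bdd: "bdd_below ?S"
    proof (rule bdd_belowI)
      fix r assume "r \<in> ?S"
      then have "- (t *\<^sub>R u) \<le> r *\<^sub>R u"
        using t(2) by auto
      then have "0 \<le> r *\<^sub>R u - - (t *\<^sub>R u)"
        by (simp only: diff_ge_0_iff_ge)
      \<comment> \<open>As \<open>u\<close> is nonnegative and nonzero, this forces
        \<open>0 \<le> r + t\<close>.\<close>
      then have "0 \<le> (r + t) *\<^sub>R u"
        by (simp add: scaleR_add_left)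
      then show "- t \<le> r"
        using u assms by (auto simp: zero_le_scaleR_iff)
    qed
    have "?S = (\<lambda>r. r *\<^sub>R u - x) -` pos_cone"
      by (auto simp: pos_cone_def)
    then have "closed ?S"
      by (auto intro!: closed_vimage closed_pos_cone continuous_intros)
    then have "Inf ?S \<in> ?S"
      using t(3) bdd by (intro closed_contains_Inf) auto
    then have "x \<le> p x *\<^sub>R u"
      using x by (simp add: p_def)
    moreover have "p x \<le> r" if "x \<le> r *\<^sub>R u"
      using that x bdd by (auto simp: p_def intro: cInf_lower)
    ultimately show ?thesis
      using u by (meson order_trans scaleR_right_mono)
  qed
  have p_self: "x \<le> p x *\<^sub>R u" if "x \<in> gen_space u" for x
    using p_le[OF that, of "p x"] by simp
  have scale_le: "p (c *\<^sub>R x) \<le> c * p x" if "x \<in> gen_space u" "0 < c" for x c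
    using that scaleR_left_mono[OF p_self[OF that(1)], of c]
    by (simp add: p_le gen.scaleR_mem)
  have "gen.max_sublinear p"
    unfolding gen.max_sublinear_def
  proof (intro conjI ballI allI impI)
    fix x y assume xy: "x \<in> gen_space u" "y \<in> gen_space u"
    show "p (x + y) \<le> p x + p y"
      using xy add_mono[OF p_self p_self, OF xy] by (simp add: p_le gen.add_mem scaleR_add_left)
    \<comment> \<open>Two reals with the same upper bounds are equal.\<close>
    have "p (sup x y) \<le> r \<longleftrightarrow> max (p x) (p y) \<le> r" for r
      using xy by (simp add: p_le gen.sup_mem)
    then show "p (sup x y) = max (p x) (p y)"
      by (metis antisym order_refl)
  next
    fix x and c :: real assume x: "x \<in> gen_space u" and c: "0 < c"
    have "p (inverse c *\<^sub>R (c *\<^sub>R x)) \<le> inverse c * p (c *\<^sub>R x)"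
      using x c by (intro scale_le gen.scaleR_mem) auto
    then have "p x \<le> inverse c * p (c *\<^sub>R x)"
      using c by simp
    then have "c * p x \<le> p (c *\<^sub>R x)"
      using c by (simp add: field_simps)
    then show "p (c *\<^sub>R x) = c * p x"
      using scale_le[OF x c] by simp
  next
    fix x assume "x \<notin> gen_space u"
    then show "p x = 0"
      by (simp add: p_def)
  qed
  with p_le show thesis
    by (rule that[rotated])
qed

text \<open>Shifting the gauge \<open>p\<close> by \<open>a\<close> before taking a linear minorant
  \<open>k\<close> ensures \<open>k (- a) \<le> - p a\<close>, hence
  \<open>k a \<ge> p a > 0\<close>. Here \<open>p a\<close> is positive since
  \<open>a \<le> 0\<close> fails.\<close>

lemma ex_unit_hom_pos:
  assumes a: "a \<in> gen_space u" "\<not> a \<le> 0"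
  shows "\<exists>k\<in>unit_homs u. 0 < k a"
proof -
  have "u \<noteq> 0"
    using a unfolding mem_gen_space by auto
  then obtain p where p: "gen.max_sublinear p"
    and p_le: "\<And>x r. x \<in> gen_space u \<Longrightarrow> p x \<le> r \<longleftrightarrow> x \<le> r *\<^sub>R u"
    by (rule gen_space_gauge) blast
  obtain q where q: "gen.max_sublinear q" "q \<le> p" "q (- a) \<le> - p a"
    using gen.max_sublinear_shift[OF p a(1)] by auto
  obtain k where k: "k \<le> q" "gen.max_sublinear k"
    "\<forall>x\<in>gen_space u. \<forall>y\<in>gen_space u. k (x + y) = k x + k y"
    "\<forall>c. \<forall>x\<in>gen_space u. k (c *\<^sub>R x) = c * k x"
    using gen.ex_lattice_hom_le[OF q(1)] by auto
  have minus: "k (- x) = - k x" if "x \<in> gen_space u" for x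
    using k(4)[rule_format, OF that, of "-1"] by simp
  have "k u \<le> p u" "k (- u) \<le> p (- u)"
    using k(1) q(2) by (auto simp: le_fun_def intro: order_trans)
  \<comment> \<open>The bounds at \<open>u\<close> and \<open>- u\<close> pinch the linear
    functional \<open>k\<close> to the value 1 at \<open>u\<close>.\<close>
  moreover have "p u \<le> 1" "p (- u) \<le> - 1"
    using unit_mem gen.minus_mem[OF unit_mem] by (auto simp: p_le)
  ultimately have "k u = 1"
    using minus[OF unit_mem] by simp
  moreover have "0 < p a"
    using p_le[OF a(1), of 0] a(2) by simp
  then have "0 < k a"
    using q(3) k(1) minus[OF a(1)] by (force dest: le_funD[of _ _ "- a"])
  moreover have "k x = 0" if "x \<notin> gen_space u" for x
    using gen.max_sublinear_outside[OF k(2) that] .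
  moreover have "k (sup x y) = max (k x) (k y)" if "x \<in> gen_space u" "y \<in> gen_space u" for x y
    using gen.max_sublinear_sup[OF k(2) that] .
  ultimately show ?thesis
    using k(3,4) unfolding unit_homs_def by (intro bexI[of _ k]) auto
qed

section \<open>Order and norm recovered from the unital homomorphisms\<close>

context
  fixes k assumes k: "k \<in> unit_homs u"
begin

lemma unit_hom_add: "x \<in> gen_space u \<Longrightarrow> y \<in> gen_space u \<Longrightarrow> k (x + y) = k x + k y"
  and unit_hom_scaleR: "x \<in> gen_space u \<Longrightarrow> k (c *\<^sub>R x) = c * k x"
  and unit_hom_sup: "x \<in> gen_space u \<Longrightarrow> y \<in> gen_space u \<Longrightarrow> k (sup x y) = max (k x) (k y)"
  and unit_hom_outside: "x \<notin> gen_space u \<Longrightarrow> k x = 0"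
  and unit_hom_unit: "k u = 1"
  using k unfolding unit_homs_def by auto

lemma unit_hom_minus: "x \<in> gen_space u \<Longrightarrow> k (- x) = - k x"
  using unit_hom_scaleR[of x "-1"] by simp

lemma unit_hom_diff: "x \<in> gen_space u \<Longrightarrow> y \<in> gen_space u \<Longrightarrow> k (x - y) = k x - k y"
  using unit_hom_add[of x "- y"] gen.minus_mem unit_hom_minus by simp

lemma unit_hom_mono: "x \<in> gen_space u \<Longrightarrow> y \<in> gen_space u \<Longrightarrow> x \<le> y \<Longrightarrow> k x \<le> k y"
  using unit_hom_sup[of x y] by (simp add: sup_absorb2)

end

lemma unit_homs_le_iff:
  assumes "x \<in> gen_space u" "y \<in> gen_space u"
  shows "(\<forall>k\<in>unit_homs u. k x \<le> k y) \<longleftrightarrow> x \<le> y"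
proof
  assume le: "\<forall>k\<in>unit_homs u. k x \<le> k y"
  show "x \<le> y"
  proof (rule ccontr)
    assume "\<not> x \<le> y"
    then obtain k where "k \<in> unit_homs u" "0 < k (x - y)"
      using ex_unit_hom_pos[of "x - y"] gen.diff_mem assms by auto
    then show False
      using le assms unit_hom_diff by force
  qed
qed (use assms unit_hom_mono in blast)

lemma unit_homs_abs_le_iff:
  assumes x: "x \<in> gen_space u"
  shows "(\<forall>k\<in>unit_homs u. \<bar>k x\<bar> \<le> t) \<longleftrightarrow> - (t *\<^sub>R u) \<le> x \<and> x \<le> t *\<^sub>R u"
proof -
  note mem = gen.scaleR_mem[OF unit_mem, of t] gen.minus_mem
  have "- (t *\<^sub>R u) \<le> x \<and> x \<le> t *\<^sub>R u \<longleftrightarrow>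
      (\<forall>k\<in>unit_homs u. k (- (t *\<^sub>R u)) \<le> k x) \<and> (\<forall>k\<in>unit_homs u. k x \<le> k (t *\<^sub>R u))"
    using x mem by (simp add: unit_homs_le_iff)
  also have "\<dots> \<longleftrightarrow> (\<forall>k\<in>unit_homs u. \<bar>k x\<bar> \<le> t)"
    using mem by (auto simp: unit_hom_minus unit_hom_scaleR unit_mem unit_hom_unit abs_le_iff)
  finally show ?thesis
    by simp
qed

text \<open>An order bound of \<open>x\<close> by a multiple of \<open>u\<close> bounds all values
  \<open>k x\<close> at once, so the set is a closed subset of a product of compact intervals, and
  Tychonoff's theorem applies.\<close>

lemma compact_unit_homs: "compact (unit_homs u)"
proof -
  have "\<exists>t. x \<in> gen_space u \<longrightarrow> - (t *\<^sub>R u) \<le> x \<and> x \<le> t *\<^sub>R u" for x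
    unfolding mem_gen_space by auto
  then obtain b where b: "\<And>x. x \<in> gen_space u \<Longrightarrow> - (b x *\<^sub>R u) \<le> x \<and> x \<le> b x *\<^sub>R u"
    by metis
  \<comment> \<open>Outside \<open>gen_space u\<close> the number \<open>b x\<close> is arbitrary;
    its absolute value keeps 0 in the interval.\<close>
  have "compactin (product_topology (\<lambda>_::'a. euclideanreal) UNIV) (PiE UNIV (\<lambda>x. {- \<bar>b x\<bar>..\<bar>b x\<bar>}))"
    by (simp add: compactin_PiE)
  then have "compact (PiE UNIV (\<lambda>x. {- \<bar>b x\<bar>..\<bar>b x\<bar>}))"
    by (simp add: euclidean_product_topology)
  moreover have "unit_homs u \<subseteq> PiE UNIV (\<lambda>x. {- \<bar>b x\<bar>..\<bar>b x\<bar>})"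
  proof
    fix k assume k: "k \<in> unit_homs u"
    have "\<bar>k x\<bar> \<le> \<bar>b x\<bar>" for x
    proof (cases "x \<in> gen_space u")
      case True
      then have "\<bar>k x\<bar> \<le> b x"
        using b k unit_homs_abs_le_iff by blast
      then show ?thesis
        by simp
    qed (simp add: unit_hom_outside[OF k])
    then show "k \<in> PiE UNIV (\<lambda>x. {- \<bar>b x\<bar>..\<bar>b x\<bar>})"
      by (auto simp: abs_le_iff minus_le_iff)
  qed
  ultimately show ?thesis
    using closed_unit_homs by (metis compact_Int_closed inf.absorb_iff2)
qed

text \<open>By \<open>unit_homs_abs_le_iff\<close>, the scaled interval of factor
  \<open>t > 0\<close> contains \<open>x\<close> exactly when \<open>t\<close> bounds all
  \<open>\<bar>k x\<bar>\<close>; both sides are the infimum of these \<open>t\<close>.\<close>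

lemma gen_norm_eq_Sup:
  assumes x: "x \<in> gen_space u"
  shows "gen_norm u x = Sup (insert 0 ((\<lambda>k. \<bar>k x\<bar>) ` unit_homs u))"
proof -
  obtain t where "- (t *\<^sub>R u) \<le> x \<and> x \<le> t *\<^sub>R u"
    using x unfolding mem_gen_space by auto
  then have "bdd_above ((\<lambda>k. \<bar>k x\<bar>) ` unit_homs u)"
    using unit_homs_abs_le_iff[OF x] by (intro bdd_aboveI2[of _ _ t]) blast
  then have "Sup (insert 0 ((\<lambda>k. \<bar>k x\<bar>) ` unit_homs u)) =
      Inf {t. 0 < t \<and> (\<forall>k\<in>unit_homs u. \<bar>k x\<bar> \<le> t)}"
    by (simp flip: Inf_pos_upper_bounds)
  also have "{t. 0 < t \<and> (\<forall>k\<in>unit_homs u. \<bar>k x\<bar> \<le> t)} =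
      {t. 0 < t \<and> x \<in> (\<lambda>y. t *\<^sub>R y) ` {- u..u}}"
    using unit_homs_abs_le_iff[OF x] mem_scaled_interval by blast
  finally show ?thesis
    by (simp add: gen_norm_def)
qed

section \<open>Surjectivity onto the continuous functions: density and completeness\<close>

lemma gen_space_dense:
  assumes f: "continuous_on (unit_homs u) f" and "0 < e"
  shows "\<exists>x\<in>gen_space u. \<forall>k\<in>unit_homs u. \<bar>f k - k x\<bar> < e"
proof (cases "unit_homs u = {}")
  case True
  then show ?thesis
    using unit_mem by blast
next
  case False
  define F where "F = {g. \<exists>x\<in>gen_space u. \<forall>k\<in>unit_homs u. g k = k x}"
  have "\<exists>g\<in>F. \<forall>k\<in>unit_homs u. \<bar>f k - g k\<bar> < e"
  proof (rule lattice_Stone_Weierstrass[OF compact_unit_homs False _ _ _ _ f \<open>0 < e\<close>])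
    fix g assume "g \<in> F"
    then obtain x where "\<forall>k\<in>unit_homs u. g k = k x"
      by (auto simp: F_def)
    moreover have "continuous_on (unit_homs u) (\<lambda>k. k x)"
      by (rule continuous_on_subset[OF continuous_on_product_coordinates]) simp
    ultimately show "continuous_on (unit_homs u) g"
      by (simp cong: continuous_on_cong)
  next
    fix g h assume "g \<in> F" "h \<in> F"
    then obtain x y where xy: "x \<in> gen_space u" "y \<in> gen_space u"
      and gh: "\<forall>k\<in>unit_homs u. g k = k x" "\<forall>k\<in>unit_homs u. h k = k y"
      by (auto simp: F_def)
    show "(\<lambda>k. max (g k) (h k)) \<in> F"
      using xy gh by (auto simp: F_def unit_hom_sup intro!: bexI[of _ "sup x y"] gen.sup_mem)
    show "(\<lambda>k. min (g k) (h k)) \<in> F"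
      unfolding F_def
    proof (intro CollectI bexI ballI)
      \<comment> \<open>Minima are obtained from suprema by negation.\<close>
      show "- sup (- x) (- y) \<in> gen_space u"
        using xy by (intro gen.minus_mem gen.sup_mem)
      fix k assume k: "k \<in> unit_homs u"
      have "k (- sup (- x) (- y)) = - max (- k x) (- k y)"
        using xy unit_hom_minus[OF k] unit_hom_sup[OF k]
        by (simp only: gen.minus_mem gen.sup_mem)
      then show "min (g k) (h k) = k (- sup (- x) (- y))"
        using gh k by (simp add: min_def max_def)
    qed
  next
    fix a b assume ab: "a \<in> unit_homs u" "b \<in> unit_homs u"
    have "\<exists>x\<in>gen_space u. a x = f a \<and> b x = f b"
    proof (cases "a = b")
      case True
      then show ?thesis
        using ab by (intro bexI[of _ "f a *\<^sub>R u"])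
          (auto simp: unit_hom_scaleR unit_mem unit_hom_unit gen.scaleR_mem)
    next
      case False
      then obtain y where "a y \<noteq> b y"
        by blast
      \<comment> \<open>Both homomorphisms vanish outside \<open>gen_space u\<close>, so a point
        where they differ lies inside.\<close>
      then have y: "y \<in> gen_space u"
        using unit_hom_outside[OF ab(1), of y] unit_hom_outside[OF ab(2), of y] by argo
      \<comment> \<open>Linear interpolation: \<open>y - a y *\<^sub>R u\<close> vanishes under
        \<open>a\<close> and has value \<open>b y - a y\<close> under \<open>b\<close>.\<close>
      define c where "c = (f b - f a) / (b y - a y)"
      define x where "x = f a *\<^sub>R u + c *\<^sub>R (y - a y *\<^sub>R u)"
      have "k x = f a + c * (k y - a y)" if "k \<in> unit_homs u" for k
        using that y by (simp add: x_def unit_hom_add unit_hom_diff unit_hom_scaleR unit_hom_unit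
            unit_mem gen.add_mem gen.diff_mem gen.scaleR_mem)
      from this[OF ab(1)] this[OF ab(2)] have "a x = f a" "b x = f b"
        using \<open>a y \<noteq> b y\<close> by (simp_all add: c_def)
      moreover have "x \<in> gen_space u"
        unfolding x_def using y by (intro gen.add_mem gen.diff_mem gen.scaleR_mem unit_mem)
      ultimately show ?thesis
        by blast
    qed
    then show "\<exists>g\<in>F. g a = f a \<and> g b = f b"
      by (auto simp: F_def)
  qed
  then show ?thesis
    by (force simp: F_def)
qed

text \<open>Uniform closeness on the homomorphisms becomes order bounds by multiples of
  \<open>u\<close>, and these give norm bounds. The limit is taken in the complete ambient space,
  and closedness of the cone carries the order bounds over to it.\<close>

lemma gen_space_complete:
  assumes X: "\<And>n. X n \<in> gen_space u"
    and X_close: "\<And>n k. k \<in> unit_homs u \<Longrightarrow> \<bar>f k - k (X n)\<bar> \<le> e n"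
    and e: "e \<longlonglongrightarrow> 0"
  shows "\<exists>x\<in>gen_space u. \<forall>k\<in>unit_homs u. k x = f k"
proof -
  have between: "- ((e m + e n) *\<^sub>R u) \<le> X m - X n \<and> X m - X n \<le> (e m + e n) *\<^sub>R u" for m n
  proof -
    have "\<bar>k (X m - X n)\<bar> \<le> e m + e n" if "k \<in> unit_homs u" for k
      using X_close[OF that, of m] X_close[OF that, of n] unit_hom_diff[OF that X X] by simp
    then show ?thesis
      using unit_homs_abs_le_iff[OF gen.diff_mem[OF X X]] by blast
  qed
  have norm_le: "norm (X m - X n) \<le> \<bar>e m + e n\<bar> * norm u" for m n
  proof -
    have "\<bar>X m - X n\<bar> \<le> (e m + e n) *\<^sub>R u"
      using between[of m n] by (intro abs_leI) (simp_all add: minus_le_iff)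
    then have "norm \<bar>X m - X n\<bar> \<le> norm ((e m + e n) *\<^sub>R u)"
      by (intro norm_mono_nonneg) simp_all
    then show ?thesis
      by (simp add: norm_abs_lattice)
  qed
  have "Cauchy X"
  proof (rule CauchyI)
    fix r :: real assume "0 < r"
    \<comment> \<open>The added 1 avoids division by zero when \<open>u = 0\<close>.\<close>
    define d where "d = r / (2 * (norm u + 1))"
    have "0 < d"
      using \<open>0 < r\<close> by (simp add: d_def add_nonneg_pos)
    then obtain N where N: "\<And>n. n \<ge> N \<Longrightarrow> \<bar>e n\<bar> < d"
      using LIMSEQ_D[OF e] by force
    have "norm (X m - X n) < r" if "m \<ge> N" "n \<ge> N" for m n
    proof -
      have "\<bar>e m + e n\<bar> * norm u \<le> (2 * d) * norm u"
        using N[OF that(1)] N[OF that(2)] by (intro mult_right_mono) auto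
      also have "\<dots> < (2 * d) * (norm u + 1)"
        using \<open>0 < d\<close> by simp
      also have "\<dots> = r"
        using add_nonneg_pos[of "norm u" 1] by (simp add: d_def field_simps)
      finally show ?thesis
        using norm_le[of m n] by linarith
    qed
    then show "\<exists>N. \<forall>m\<ge>N. \<forall>n\<ge>N. norm (X m - X n) < r"
      by blast
  qed
  then obtain x where x: "X \<longlonglongrightarrow> x"
    using Cauchy_convergent convergent_def by blast
  \<comment> \<open>Let \<open>n\<close> tend to infinity in \<open>between\<close>.\<close>
  have lim_le: "- (e m *\<^sub>R u) \<le> X m - x \<and> X m - x \<le> e m *\<^sub>R u" for m
  proof
    have "(\<lambda>n. X m - X n) \<longlonglongrightarrow> X m - x" "(\<lambda>n. (e m + e n) *\<^sub>R u) \<longlonglongrightarrow> (e m + 0) *\<^sub>R u"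
      "(\<lambda>n. - ((e m + e n) *\<^sub>R u)) \<longlonglongrightarrow> - ((e m + 0) *\<^sub>R u)"
      by (intro tendsto_intros x e)+
    note lims = this[simplified]
    show "X m - x \<le> e m *\<^sub>R u"
      using between by (intro tendsto_lattice_le[OF _ lims(1,2)]) auto
    show "- (e m *\<^sub>R u) \<le> X m - x"
      using between by (intro tendsto_lattice_le[OF _ lims(3,1)]) auto
  qed
  have diff: "X m - x \<in> gen_space u" for m
    using lim_le[of m] by (intro gen_spaceI[of "e m"]) auto
  \<comment> \<open>Membership comes from \<open>x = X 0 - (X 0 - x)\<close>.\<close>
  have x_mem: "x \<in> gen_space u"
    using gen.diff_mem[OF X diff, of 0 0] by simp
  have "k x = f k" if k: "k \<in> unit_homs u" for k
  proof -
    have "\<bar>k x - f k\<bar> \<le> e m + e m" for m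
    proof -
      have "\<bar>k (X m - x)\<bar> \<le> e m"
        using unit_homs_abs_le_iff[OF diff] lim_le k by blast
      then show ?thesis
        using X_close[OF k, of m] unit_hom_diff[OF k X x_mem, of m] by simp
    qed
    moreover have "(\<lambda>m. e m + e m) \<longlonglongrightarrow> 0"
      using tendsto_add[OF e e] by simp
    ultimately have "\<bar>k x - f k\<bar> \<le> 0"
      by (intro LIMSEQ_le_const[of "\<lambda>m. e m + e m"]) auto
    then show ?thesis
      by simp
  qed
  with x_mem show ?thesis
    by blast
qed

lemma gen_space_surj:
  assumes f: "continuous_on (unit_homs u) f"
  shows "\<exists>x\<in>gen_space u. \<forall>k\<in>unit_homs u. k x = f k"
proof -
  have "\<forall>n. \<exists>x\<in>gen_space u. \<forall>k\<in>unit_homs u. \<bar>f k - k x\<bar> < (1/2)^n"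
    using gen_space_dense[OF f] by simp
  then obtain X where X: "\<And>n. X n \<in> gen_space u"
    "\<And>n k. k \<in> unit_homs u \<Longrightarrow> \<bar>f k - k (X n)\<bar> < (1/2)^n"
    by metis
  have "(\<lambda>n. (1/2::real)^n) \<longlonglongrightarrow> 0"
    by (intro LIMSEQ_power_zero) simp
  then show ?thesis
    using X by (intro gen_space_complete[of X f]) (auto intro: less_imp_le)
qed

lemma gen_space_order_isometric:
  "order_isometric_C (gen_space u) (gen_norm u) (top_of_set (unit_homs u))"
proof -
  \<comment> \<open>The isometry sends \<open>x\<close> to evaluation at \<open>x\<close>;
    \<open>restrict\<close> selects the extensional representative that \<open>C_space\<close>
    demands.\<close>
  define T :: "'a \<Rightarrow> ('a \<Rightarrow> real) \<Rightarrow> real" where "T x = restrict (\<lambda>k. k x) (unit_homs u)" for x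
  have "T ` gen_space u = C_space (top_of_set (unit_homs u))"
  proof (intro equalityI subsetI)
    fix f assume "f \<in> T ` gen_space u"
    then obtain x where x: "f = T x"
      by auto
    have "continuous_on (unit_homs u) (\<lambda>k. k x)"
      by (rule continuous_on_subset[OF continuous_on_product_coordinates]) simp
    then show "f \<in> C_space (top_of_set (unit_homs u))"
      by (simp add: C_space_def x T_def cong: continuous_on_cong)
  next
    fix f assume "f \<in> C_space (top_of_set (unit_homs u))"
    then have f: "f \<in> extensional (unit_homs u)" "continuous_on (unit_homs u) f"
      by (auto simp: C_space_def)
    obtain x where "x \<in> gen_space u" "\<forall>k\<in>unit_homs u. k x = f k"
      using gen_space_surj[OF f(2)] by auto
    moreover from this have "f = T x"
      using f(1) by (auto simp: T_def intro!: extensionalityI)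
    ultimately show "f \<in> T ` gen_space u"
      by blast
  qed
  moreover have "\<forall>x\<in>gen_space u. C_norm (top_of_set (unit_homs u)) (T x) = gen_norm u x"
    by (simp add: C_norm_def gen_norm_eq_Sup T_def cong: image_cong)
  moreover have "\<forall>x\<in>gen_space u. \<forall>y\<in>gen_space u.
      (\<forall>k\<in>unit_homs u. T y k \<le> T x k) \<longleftrightarrow> y \<le> x"
    using unit_homs_le_iff by (simp add: T_def)
  ultimately show ?thesis
    unfolding order_isometric_C_def
    by (intro exI[of _ T]) (simp add: T_def unit_hom_add unit_hom_scaleR)
qed

end

(* HOL cannot quantify existentially over the type of the points of K.  They are taken of type
   'a \<Rightarrow> real, which loses nothing: the points of K can be realised as evaluation functionals
   on the generating space, extended by 0. *)
theorem theorem12: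
  assumes "separable_space (euclidean :: 'a::banach_lattice topology)"
  shows "nonsupport_points (pos_cone :: 'a set) \<noteq> {} \<and>
    (\<forall>u \<in> nonsupport_points (pos_cone :: 'a set).
       \<exists>K :: ('a \<Rightarrow> real) topology. compact_space K \<and> Hausdorff_space K \<and>
         order_isometric_C (gen_space u) (gen_norm u) K)"
proof (intro conjI ballI)
  show "nonsupport_points (pos_cone :: 'a set) \<noteq> {}"
    using assms by (rule ex_nonsupport_point)
  fix u :: 'a assume "u \<in> nonsupport_points pos_cone"
  then have u: "0 \<le> u"
    by (simp add: nonsupport_points_def pos_cone_def)
  have "Hausdorff_space (euclidean :: ('a \<Rightarrow> real) topology)"
    by (simp flip: euclidean_product_topology add: Hausdorff_space_product_topology)
  then have "Hausdorff_space (top_of_set (unit_homs u))"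
    by (rule Hausdorff_space_subtopology)
  moreover have "compact_space (top_of_set (unit_homs u))"
    using compact_unit_homs[OF u] by (simp add: compact_space_subtopology)
  ultimately show "\<exists>K :: ('a \<Rightarrow> real) topology. compact_space K \<and> Hausdorff_space K \<and>
      order_isometric_C (gen_space u) (gen_norm u) K"
    using gen_space_order_isometric[OF u] by blast
qed

end
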